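(* Let $(X,Y,\pi,\nu)$ be a factor quadruple with finite degree $d$ and let $\lambda$ be a degree joining over $\nu$ with respect to $\pi$. Then $$\{p_i\lambda: 1\le i\le d\}$$ is the set of all ergodic measures $\mu\in E(X)$ with $\pi\mu=\nu$.
   Context: A topological dynamical system $(X,T)$ is a compact metric space $X$ with a homeomorphism $T:X\to X$. "Measure" means Borel probability measure; $E(X)=E(X,T)$ is the set of ergodic $T$-invariant measures. A factor map $\pi:(X,T)\to(Y,S)$ is a continuous surjection with $\pi\circ T=S\circ\pi$. For a measure $\mu$ on $X$, $\pi\mu$ denotes the pushforward $\mu\circ\pi^{-1}$ (similarly for other maps). A factor quadruple $(X,Y,\pi,\nu)$ consists of a factor map $\pi:(X,T)\to(Y,S)$ between topological dynamical systems and $\nu\in E(Y,S)$. The function $y\mapsto|\pi^{-1}(y)|\in\{1,2,\dots\}\cup\{\infty\}$ is $\nu$-a.e. constant; the constant is the degree $d_{\pi,\nu}$ of the quadruple. $X^n$ carries the product action $T\times\cdots\times T$, and $p_i:X^n\to X$ is the $i$-th coordinate projection. The fiber product is $X^n_\pi=\{(x_1,\dots,x_n)\in X^n:\pi(x_1)=\cdots=\pi(x_n)\}$. An $n$-fold $\pi$-relative joining is an invariant measure $\lambda$ on $X^n$ with $\lambda(X^n_\pi)=1$; it is over $\nu$ if $\pi p_i\lambda=\nu$ for some (equivalently all) $i$. It is separating if for $\lambda$-a.e. $(x_1,\dots,x_n)$ the points $x_1,\dots,x_n$ are pairwise distinct. If $d=d_{\pi,\nu}<\infty$, a degree joining over $\nu$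 with respect to $\pi$ is a $d$-fold ergodic separating $\pi$-relative joining over $\nu$ (a measure on $X^d$). *)

theory Defs
  imports "HOL-Probability.Probability"
begin

text \<open>
  A compact metric space is a type of the following class. Since such a type is second countable,
  the product sigma-algebra \<open>PiM {1..n} (\<lambda>_. borel)\<close> used below for \<open>X\<^sup>n\<close> is its Borel sigma-algebra.
\<close>

class compact_metric_space = metric_space +
  assumes compact_space: "compact (UNIV :: 'a set)"

lemma compact_metric_countable_subbasis:
  "\<exists>B :: 'a::compact_metric_space set set. countable B \<and> open = generate_topology B"
proof -
  have "\<exists>k. finite k \<and> (UNIV :: 'a set) \<subseteq> (\<Union>x\<in>k. ball x (inverse (real (Suc n))))" for n
    using compact_space[where 'a='a] unfolding compact_eq_totally_bounded
    by (metis inverse_positive_iff_positive of_nat_0_less_iff zero_less_Suc)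
  then obtain k where k: "\<And>n. finite (k n)"
    "\<And>n. (UNIV :: 'a set) \<subseteq> (\<Union>x\<in>k n. ball x (inverse (real (Suc n))))"
    by metis
  define B where "B = (\<Union>n. (\<lambda>x. ball x (inverse (real (Suc n)))) ` k n)"
  have cB: "countable B"
    unfolding B_def using k(1) by (auto intro: countable_finite)
  have basis: "topological_basis B"
  proof (rule topological_basisI)
    show "open b" if "b \<in> B" for b using that by (auto simp: B_def)
    fix U :: "'a set" and x assume "open U" "x \<in> U"
    then obtain e where e: "e > 0" "ball x e \<subseteq> U" by (meson open_contains_ball)
    obtain n where n: "inverse (real (Suc n)) < e / 2"
      using reals_Archimedean[of "e / 2"] e(1) by auto
    obtain c where c: "c \<in> k n" "x \<in> ball c (inverse (real (Suc n)))"
      using k(2)[of n] by blast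
    have "ball c (inverse (real (Suc n))) \<subseteq> ball x e"
    proof
      fix y assume "y \<in> ball c (inverse (real (Suc n)))"
      moreover have "dist x y \<le> dist c x + dist c y"
        by (metis dist_commute dist_triangle)
      ultimately show "y \<in> ball x e" using c(2) n by (auto simp only: mem_ball)
    qed
    then show "\<exists>b\<in>B. x \<in> b \<and> b \<subseteq> U" using c e(2) by (auto simp: B_def intro!: exI[of _ n])
  qed
  show ?thesis
  proof (intro exI conjI ext iffI)
    show "countable B" by (fact cB)
    fix U :: "'a set"
    show "generate_topology B U" if "open U"
    proof -
      from basis \<open>open U\<close> obtain B' where "B' \<subseteq> B" "\<Union>B' = U"
        by (auto simp: topological_basis_def)
      then show ?thesis by (metis generate_topology.UN generate_topology.Basis subsetD)
    qed
    show "open U" if "generate_topology B U"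
      using that by induct (auto intro: topological_basis_open[OF basis])
  qed
qed

instance compact_metric_space \<subseteq> polish_space
proof
  show "\<exists>B :: 'a set set. countable B \<and> open = generate_topology B"
    by (rule compact_metric_countable_subbasis)
  show "convergent X" if "Cauchy X" for X :: "nat \<Rightarrow> 'a"
    using compact_imp_complete[OF compact_space[where 'a='a]] that
    by (auto simp: complete_def convergent_def)
qed

definition top_dyn_system :: "('a::compact_metric_space \<Rightarrow> 'a) \<Rightarrow> bool" where
  "top_dyn_system T \<longleftrightarrow> (\<exists>T'. homeomorphism UNIV UNIV T T')"

definition factor_map ::
  "('a::compact_metric_space \<Rightarrow> 'a) \<Rightarrow> ('b::compact_metric_space \<Rightarrow> 'b) \<Rightarrow> ('a \<Rightarrow> 'b) \<Rightarrow> bool" where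
  "factor_map T S \<pi> \<longleftrightarrow> top_dyn_system T \<and> top_dyn_system S \<and>
     continuous_on UNIV \<pi> \<and> surj \<pi> \<and> \<pi> \<circ> T = S \<circ> \<pi>"

text \<open>
  In the next two definitions the measure \<open>M\<close> only supplies the underlying measurable space.
\<close>

definition invariant_measures :: "'a measure \<Rightarrow> ('a \<Rightarrow> 'a) \<Rightarrow> 'a measure set" where
  "invariant_measures M T = {\<mu>. prob_space \<mu> \<and> sets \<mu> = sets M \<and> distr \<mu> M T = \<mu>}"

definition ergodic_measures :: "'a measure \<Rightarrow> ('a \<Rightarrow> 'a) \<Rightarrow> 'a measure set" where
  "ergodic_measures M T = {\<mu> \<in> invariant_measures M T.
     \<forall>A\<in>sets M. T -` A \<inter> space M = A \<longrightarrow> emeasure \<mu> A = 0 \<or> emeasure \<mu> A = 1}"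

definition factor_quadruple ::
  "('a::compact_metric_space \<Rightarrow> 'a) \<Rightarrow> ('b::compact_metric_space \<Rightarrow> 'b) \<Rightarrow> ('a \<Rightarrow> 'b) \<Rightarrow> 'b measure \<Rightarrow> bool"
  where
  "factor_quadruple T S \<pi> \<nu> \<longleftrightarrow> factor_map T S \<pi> \<and> \<nu> \<in> ergodic_measures borel S"

definition fiber_card :: "('a \<Rightarrow> 'b) \<Rightarrow> 'b \<Rightarrow> enat" where
  "fiber_card \<pi> y = (if finite (\<pi> -` {y}) then enat (card (\<pi> -` {y})) else \<infinity>)"

text \<open>
  For a factor quadruple the cardinality of the fiber is almost everywhere constant, so the
  following description is proper.
\<close>

definition factor_degree :: "('a \<Rightarrow> 'b) \<Rightarrow> 'b measure \<Rightarrow> enat" where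
  "factor_degree \<pi> \<nu> = (THE c. AE y in \<nu>. fiber_card \<pi> y = c)"

definition power_space :: "nat \<Rightarrow> (nat \<Rightarrow> 'a::topological_space) measure" where
  "power_space n = PiM {1..n} (\<lambda>_. borel)"

definition power_map :: "nat \<Rightarrow> ('a \<Rightarrow> 'a) \<Rightarrow> (nat \<Rightarrow> 'a) \<Rightarrow> (nat \<Rightarrow> 'a)" where
  "power_map n T x = (\<lambda>i\<in>{1..n}. T (x i))"

definition fiber_product :: "nat \<Rightarrow> ('a \<Rightarrow> 'b) \<Rightarrow> (nat \<Rightarrow> 'a) set" where
  "fiber_product n \<pi> = {x \<in> {1..n} \<rightarrow>\<^sub>E UNIV. \<forall>i\<in>{1..n}. \<forall>j\<in>{1..n}. \<pi> (x i) = \<pi> (x j)}"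

definition relative_joining ::
  "nat \<Rightarrow> ('a::compact_metric_space \<Rightarrow> 'a) \<Rightarrow> ('a \<Rightarrow> 'b) \<Rightarrow> (nat \<Rightarrow> 'a) measure \<Rightarrow> bool" where
  "relative_joining n T \<pi> J \<longleftrightarrow>
     J \<in> invariant_measures (power_space n) (power_map n T) \<and> emeasure J (fiber_product n \<pi>) = 1"

definition joining_over ::
  "nat \<Rightarrow> ('a::compact_metric_space \<Rightarrow> 'b::compact_metric_space) \<Rightarrow> 'b measure \<Rightarrow> (nat \<Rightarrow> 'a) measure \<Rightarrow> bool"
  where
  "joining_over n \<pi> \<nu> J \<longleftrightarrow> (\<exists>i\<in>{1..n}. distr (distr J borel (\<lambda>x. x i)) borel \<pi> = \<nu>)"

definition separating :: "nat \<Rightarrow> (nat \<Rightarrow> 'a) measure \<Rightarrow> bool" where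
  "separating n J \<longleftrightarrow> (AE x in J. inj_on x {1..n})"

definition degree_joining ::
  "('a::compact_metric_space \<Rightarrow> 'a) \<Rightarrow> ('a \<Rightarrow> 'b::compact_metric_space) \<Rightarrow> 'b measure \<Rightarrow>
   (nat \<Rightarrow> 'a) measure \<Rightarrow> bool" where
  "degree_joining T \<pi> \<nu> J \<longleftrightarrow> (\<exists>d. factor_degree \<pi> \<nu> = enat d \<and>
     relative_joining d T \<pi> J \<and> joining_over d \<pi> \<nu> J \<and> separating d J \<and>
     J \<in> ergodic_measures (power_space d) (power_map d T))"

end

theory Submission
  imports Defs
begin

text \<open>
  Almost every point of \<open>X\<^sup>d\<close> with respect to the joining enumerates a whole fiber of \<open>\<pi>\<close>. Hence a
  set that is null for every marginal \<open>p\<^sub>i\<lambda>\<close> misses \<open>\<nu>\<close>-almost every fiber and is null for every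
  \<open>\<mu>\<close> over \<open>\<nu>\<close>. The marginals are ergodic, and an ergodic \<open>\<mu>\<close> that differs from all of them would be
  concentrated on a set that is null for each of them.
\<close>

section \<open>Ergodic measures\<close>

lemma invariant_measuresD:
  assumes "\<mu> \<in> invariant_measures M T"
  shows "prob_space \<mu>" "sets \<mu> = sets M" "space \<mu> = space M" "distr \<mu> M T = \<mu>"
  using assms by (auto simp: invariant_measures_def dest: sets_eq_imp_space_eq)

lemma ergodic_measuresD:
  assumes "\<mu> \<in> ergodic_measures M T"
  shows "\<mu> \<in> invariant_measures M T"
    "\<And>A. A \<in> sets M \<Longrightarrow> T -` A \<inter> space M = A \<Longrightarrow> emeasure \<mu> A = 0 \<or> emeasure \<mu> A = 1"
  using assms by (auto simp: ergodic_measures_def)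

lemma invariant_measure_vimage:
  assumes "\<mu> \<in> invariant_measures M T" "T \<in> measurable M M" "A \<in> sets M"
  shows "emeasure \<mu> (T -` A \<inter> space M) = emeasure \<mu> A"
proof -
  have "emeasure (distr \<mu> M T) A = emeasure \<mu> (T -` A \<inter> space \<mu>)"
    using assms invariant_measuresD(2)[OF assms(1)]
    by (intro emeasure_distr) (auto cong: measurable_cong_sets)
  then show ?thesis
    using invariant_measuresD[OF assms(1)] by simp
qed

text \<open>An equivariant map pulls \<open>T\<close>-invariant sets back to
  \<open>U\<close>-invariant ones, so the zero-one law for \<open>J\<close> carries over to the
  image measure. The case of interest is a coordinate projection of a joining.\<close>

lemma ergodic_measures_distr:
  assumes J: "J \<in> ergodic_measures N U" and U: "U \<in> measurable N N"
    and T: "T \<in> measurable M M" and f: "f \<in> measurable N M"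
    and comm: "\<And>x. x \<in> space N \<Longrightarrow> f (U x) = T (f x)"
  shows "distr J M f \<in> ergodic_measures M T"
proof -
  note J' = invariant_measuresD[OF ergodic_measuresD(1)[OF J]]
  have fJ: "f \<in> measurable J M" and UJ: "U \<in> measurable J N"
    using f U J'(2) by (auto cong: measurable_cong_sets)
  have "distr (distr J M f) M T = distr J M (T \<circ> f)"
    by (rule distr_distr[OF T fJ])
  also have "\<dots> = distr J M (f \<circ> U)"
    by (rule distr_cong) (auto simp: comm J'(3))
  also have "\<dots> = distr (distr J N U) M f"
    by (rule distr_distr[OF f UJ, symmetric])
  finally have inv: "distr (distr J M f) M T = distr J M f"
    by (simp add: J'(4))
  have "emeasure (distr J M f) A = 0 \<or> emeasure (distr J M f) A = 1"
    if A: "A \<in> sets M" "T -` A \<inter> space M = A" for A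
  proof -
    have "U -` (f -` A \<inter> space N) \<inter> space N = f -` A \<inter> space N"
    proof (intro set_eqI)
      fix x
      have "f x \<in> space M" "U x \<in> space N" if "x \<in> space N"
        using that f U by (auto dest: measurable_space)
      then show "x \<in> U -` (f -` A \<inter> space N) \<inter> space N \<longleftrightarrow> x \<in> f -` A \<inter> space N"
        using A(2) by (auto simp: comm)
    qed
    moreover have "f -` A \<inter> space N \<in> sets N"
      using f A(1) by (rule measurable_sets)
    ultimately show ?thesis
      using ergodic_measuresD(2)[OF J] A(1) by (simp add: emeasure_distr[OF fJ] J'(3))
  qed
  then show ?thesis
    using inv prob_space.prob_space_distr[OF J'(1) fJ]
    by (auto simp: ergodic_measures_def invariant_measures_def)
qed

text \<open>Both measures have total mass 1, so the inequality for the complement of a set is the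
  reverse inequality for the set itself.\<close>

lemma prob_measure_eq_of_le:
  assumes "prob_space \<mu>" "prob_space \<rho>" and sets: "sets \<mu> = sets \<rho>"
    and le: "\<And>X. X \<in> sets \<rho> \<Longrightarrow> measure \<mu> X \<le> measure \<rho> X"
  shows "\<mu> = \<rho>"
proof (rule measure_eqI[OF sets])
  interpret \<mu>: prob_space \<mu> by fact
  interpret \<rho>: prob_space \<rho> by fact
  have sp: "space \<mu> = space \<rho>" using sets by (rule sets_eq_imp_space_eq)
  fix X assume X: "X \<in> sets \<mu>"
  have "measure \<mu> (space \<mu> - X) \<le> measure \<rho> (space \<rho> - X)"
    using le[of "space \<rho> - X"] X sets sp by auto
  then have "measure \<rho> X \<le> measure \<mu> X"
    using X sets \<mu>.prob_compl[of X] \<rho>.prob_compl[of X] by auto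
  then show "emeasure \<mu> X = emeasure \<rho> X"
    using le[of X] X sets by (simp add: \<mu>.emeasure_eq_measure \<rho>.emeasure_eq_measure)
qed

text \<open>
  The sets on which \<open>\<mu> - \<rho>\<close> attains its maximum are closed under unions, preimages under \<open>T\<close> and
  monotone limits. So the limit superior of the iterated preimages of a positive Hahn set is a
  strictly invariant maximizer.
\<close>

lemma ergodic_measures_singular:
  assumes T: "T \<in> measurable M M"
    and \<mu>: "\<mu> \<in> ergodic_measures M T" and \<rho>: "\<rho> \<in> ergodic_measures M T" and neq: "\<mu> \<noteq> \<rho>"
  shows "\<exists>A\<in>sets M. emeasure \<mu> A = 1 \<and> emeasure \<rho> A = 0"
proof -
  note \<mu>' = invariant_measuresD[OF ergodic_measuresD(1)[OF \<mu>]]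
  note \<rho>' = invariant_measuresD[OF ergodic_measuresD(1)[OF \<rho>]]
  interpret \<mu>: prob_space \<mu> by fact
  interpret \<rho>: prob_space \<rho> by fact
  have [simp]: "sets \<mu> = sets M" "sets \<rho> = sets M" by fact+
  define \<delta> where "\<delta> X = measure \<mu> X - measure \<rho> X" for X
  define P where "P X = T -` X \<inter> space M" for X
  have "\<exists>Y\<in>sets \<mu>. (\<forall>X\<in>sets \<mu>. X \<subseteq> Y \<longrightarrow> emeasure \<rho> X \<le> emeasure \<mu> X) \<and>
      (\<forall>X\<in>sets \<mu>. X \<inter> Y = {} \<longrightarrow> emeasure \<mu> X \<le> emeasure \<rho> X)"
    by (rule finite_unsigned_Hahn_decomposition) (simp_all add: \<mu>.finite_measure_axioms \<rho>.finite_measure_axioms)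
  then obtain Y where Y: "Y \<in> sets M"
    and pos: "\<And>X. X \<in> sets M \<Longrightarrow> X \<subseteq> Y \<Longrightarrow> measure \<rho> X \<le> measure \<mu> X"
    and neg: "\<And>X. X \<in> sets M \<Longrightarrow> X \<inter> Y = {} \<Longrightarrow> measure \<mu> X \<le> measure \<rho> X"
    by (auto simp: \<mu>.emeasure_eq_measure \<rho>.emeasure_eq_measure)
  \<comment> \<open>Both values are compared with that of \<open>X \<inter> Y\<close>: the part
    \<open>X - Y\<close> contributes at most 0 to \<open>\<delta> X\<close>, and
    \<open>Y - X\<close> contributes at least 0 to \<open>\<delta> Y\<close>.\<close>
  have max: "\<delta> X \<le> \<delta> Y" if X: "X \<in> sets M" for X
  proof -
    have "measure \<mu> (X - Y) = measure \<mu> X - measure \<mu> (X \<inter> Y)"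
      "measure \<rho> (X - Y) = measure \<rho> X - measure \<rho> (X \<inter> Y)"
      "measure \<mu> (Y - X) = measure \<mu> Y - measure \<mu> (X \<inter> Y)"
      "measure \<rho> (Y - X) = measure \<rho> Y - measure \<rho> (X \<inter> Y)"
      using X Y by (simp_all add: \<mu>.finite_measure_Diff' \<rho>.finite_measure_Diff' Int_commute)
    moreover have "measure \<mu> (X - Y) \<le> measure \<rho> (X - Y)" "measure \<rho> (Y - X) \<le> measure \<mu> (Y - X)"
      using X Y by (auto intro!: pos neg)
    ultimately show ?thesis by (simp add: \<delta>_def)
  qed
  define \<C> where "\<C> = {X \<in> sets M. \<delta> X = \<delta> Y}"
  have un: "X \<union> Z \<in> \<C>" if "X \<in> \<C>" "Z \<in> \<C>" for X Z
  proof -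
    have XZ: "X \<in> sets M" "Z \<in> sets M" "\<delta> X = \<delta> Y" "\<delta> Z = \<delta> Y"
      using that by (auto simp: \<C>_def)
    \<comment> \<open>Neither summand on the left exceeds \<open>\<delta> Y\<close>, while the
      right-hand side is twice \<open>\<delta> Y\<close>; hence both summands attain it.\<close>
    then have "\<delta> (X \<union> Z) + \<delta> (X \<inter> Z) = \<delta> X + \<delta> Z"
      by (simp add: \<delta>_def measure_Un3 \<mu>.fmeasurable_eq_sets \<rho>.fmeasurable_eq_sets)
    then have "\<delta> (X \<union> Z) = \<delta> Y"
      using XZ max[of "X \<union> Z"] max[of "X \<inter> Z"] by auto
    then show ?thesis using XZ by (simp add: \<C>_def)
  qed
  have pre: "P X \<in> \<C>" if "X \<in> \<C>" for X
    using that T invariant_measure_vimage[OF ergodic_measuresD(1)[OF \<mu>] T, of X]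
      invariant_measure_vimage[OF ergodic_measuresD(1)[OF \<rho>] T, of X]
    by (auto simp: \<C>_def \<delta>_def P_def measure_def)
  have pres: "(P ^^ k) X \<in> \<C>" if "X \<in> \<C>" for X k
    using that by (induction k) (auto intro: pre)
  have inc: "(\<Union>n. F n) \<in> \<C>" if F: "incseq F" "\<And>n. F n \<in> \<C>" for F :: "nat \<Rightarrow> _"
  proof -
    have "(\<lambda>n. \<delta> (F n)) \<longlonglongrightarrow> \<delta> (\<Union>n. F n)"
      using F unfolding \<delta>_def
      by (intro tendsto_diff \<mu>.finite_Lim_measure_incseq \<rho>.finite_Lim_measure_incseq) (auto simp: \<C>_def)
    then have "\<delta> (\<Union>n. F n) = \<delta> Y"
      using F(2) by (simp add: \<C>_def LIMSEQ_const_iff)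
    then show ?thesis using F(2) by (auto simp: \<C>_def)
  qed
  have dec: "(\<Inter>n. F n) \<in> \<C>" if F: "decseq F" "\<And>n. F n \<in> \<C>" for F :: "nat \<Rightarrow> _"
  proof -
    have "(\<lambda>n. \<delta> (F n)) \<longlonglongrightarrow> \<delta> (\<Inter>n. F n)"
      using F unfolding \<delta>_def
      by (intro tendsto_diff \<mu>.finite_Lim_measure_decseq \<rho>.finite_Lim_measure_decseq) (auto simp: \<C>_def)
    then have "\<delta> (\<Inter>n. F n) = \<delta> Y"
      using F(2) by (simp add: \<C>_def LIMSEQ_const_iff)
    then show ?thesis using F(2) by (auto simp: \<C>_def)
  qed
  \<comment> \<open>The inner finite unions make \<open>B\<close> the limit of an increasing
    sequence in \<open>\<C>\<close>. Since \<open>P B \<subseteq> B\<close>, the iterated preimages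
    of \<open>B\<close> decrease, and \<open>A\<close> is their limit.\<close>
  define B where "B = (\<Union>n. \<Union>k\<le>n. (P ^^ k) Y)"
  define A where "A = (\<Inter>n. (P ^^ n) B)"
  have "Y \<in> \<C>" using Y by (simp add: \<C>_def)
  then have "(\<Union>k\<le>n. (P ^^ k) Y) \<in> \<C>" for n
  proof (induction n)
    case (Suc n)
    then show ?case
      using un[OF pres[of Y "Suc n"]] by (simp add: atMost_Suc)
  qed simp
  then have B: "B \<in> \<C>"
    unfolding B_def by (intro inc) (auto simp: incseq_def intro: order_trans)
  have "P B = (\<Union>k. (P ^^ Suc k) Y)"
    by (auto simp: B_def P_def)
  also have "\<dots> \<subseteq> B"
    unfolding B_def by blast
  finally have PB: "P B \<subseteq> B" .
  have mono: "mono P" by (auto simp: P_def mono_def)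
  have step: "(P ^^ Suc n) B \<subseteq> (P ^^ n) B" for n
    using funpow_mono[OF mono PB, of n] by (simp add: funpow_swap1)
  have "A \<in> \<C>"
    unfolding A_def by (intro dec pres B decseq_SucI step)
  then have A: "A \<in> sets M" "\<delta> A = \<delta> Y" by (auto simp: \<C>_def)
  \<comment> \<open>Taking preimages commutes with the intersection and only drops the first term of
    a decreasing sequence. This gives exact invariance, which the definition of ergodicity asks
    for.\<close>
  have "P A = (\<Inter>n. (P ^^ Suc n) B)"
    by (auto simp: A_def P_def)
  also have "\<dots> = A"
    unfolding A_def using step by blast
  finally have inv: "T -` A \<inter> space M = A" by (simp add: P_def)
  have "\<exists>X\<in>sets M. measure \<rho> X < measure \<mu> X"
    using prob_measure_eq_of_le[of \<mu> \<rho>] neq \<mu>' \<rho>' by (metis not_le)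
  then have "\<delta> Y > 0"
    using max unfolding \<delta>_def by fastforce
  then have "measure \<rho> A < measure \<mu> A"
    using A(2) by (simp add: \<delta>_def)
  \<comment> \<open>Ergodicity leaves only the values 0 and 1, and the strict inequality decides
    which measure takes which.\<close>
  then show ?thesis
    using A(1) ergodic_measuresD(2)[OF \<mu> A(1) inv] ergodic_measuresD(2)[OF \<rho> A(1) inv]
    by (intro bexI[of _ A]) (auto simp: measure_def)
qed

section \<open>The degree of a factor quadruple\<close>

text \<open>The closures of the members of a countable basis suffice. Around each point of
  \<open>F\<close> take a basic set within a third of a lower bound for the distance to the other
  points; by the triangle inequality two such closures cannot meet. This allows points of a fiber to
  be counted by countable set operations.\<close>

lemma separating_closed_family:
  "\<exists>\<B> :: 'a::{metric_space, second_countable_topology} set set. countable \<B> \<and> (\<forall>C\<in>\<B>. closed C) \<and>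
     (\<forall>F. finite F \<longrightarrow> (\<exists>c. \<forall>x\<in>F. c x \<in> \<B> \<and> x \<in> c x \<and> (\<forall>y\<in>F. y \<noteq> x \<longrightarrow> c x \<inter> c y = {})))"
proof -
  obtain \<U> :: "'a set set" where \<U>: "countable \<U>" "topological_basis \<U>"
    using ex_countable_basis by blast
  have "\<exists>c. \<forall>x\<in>F. c x \<in> closure ` \<U> \<and> x \<in> c x \<and> (\<forall>y\<in>F. y \<noteq> x \<longrightarrow> c x \<inter> c y = {})"
    if F: "finite F" for F
  proof -
    have "\<exists>e. \<forall>x. e x > 0 \<and> (\<forall>y\<in>F. y \<noteq> x \<longrightarrow> e x \<le> dist x y)"
      using finite_set_avoid[OF F] by metis
    then obtain e where e: "\<And>x. e x > 0" "\<And>x y. y \<in> F \<Longrightarrow> y \<noteq> x \<Longrightarrow> e x \<le> dist x y"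
      by blast
    have "\<exists>U\<in>\<U>. x \<in> U \<and> U \<subseteq> ball x (e x / 3)" for x
      by (rule topological_basisE[OF \<U>(2), of "ball x (e x / 3)" x]) (use e(1)[of x] in auto)
    then obtain U where U: "\<And>x. U x \<in> \<U>" "\<And>x. x \<in> U x" "\<And>x. U x \<subseteq> ball x (e x / 3)"
      by metis
    have cl: "closure (U x) \<subseteq> cball x (e x / 3)" for x
      using U(3)[of x] by (meson closed_cball closure_minimal ball_subset_cball order_trans)
    have "closure (U x) \<inter> closure (U y) = {}" if "x \<in> F" "y \<in> F" "y \<noteq> x" for x y
    proof -
      have False if "z \<in> closure (U x)" "z \<in> closure (U y)" for z
      proof -
        have "dist x z \<le> e x / 3" "dist y z \<le> e y / 3"
          using that cl[of x] cl[of y] by auto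
        moreover have "dist x y \<le> dist x z + dist y z"
          by (rule dist_triangle2)
        moreover have "e x \<le> dist x y" "e y \<le> dist x y"
          using e(2)[of y x] e(2)[of x y] \<open>x \<in> F\<close> \<open>y \<in> F\<close> \<open>y \<noteq> x\<close> by (auto simp: dist_commute)
        ultimately show False using e(1)[of x] by linarith
      qed
      then show ?thesis by blast
    qed
    then show ?thesis
      using U closure_subset by (intro exI[of _ "\<lambda>x. closure (U x)"]) blast
  qed
  then show ?thesis
    using \<U>(1) by (intro exI[of _ "closure ` \<U>"]) auto
qed

text \<open>Finite subsets as witnesses let finite and infinite fibers be treated alike.\<close>

lemma enat_le_fiber_card_iff:
  "enat n \<le> fiber_card \<pi> y \<longleftrightarrow> (\<exists>F. finite F \<and> card F = n \<and> F \<subseteq> \<pi> -` {y})"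
proof (cases "finite (\<pi> -` {y})")
  case True
  then show ?thesis
    by (auto simp: fiber_card_def intro: card_mono) (metis obtain_subset_with_card_n)
next
  case False
  then show ?thesis
    by (auto simp: fiber_card_def) (metis infinite_arbitrarily_large)
qed

text \<open>
  The fiber over \<open>y\<close> has at least \<open>n\<close> points iff it meets \<open>n\<close> pairwise disjoint members of a suitable
  countable family of compact sets, so that the set of such \<open>y\<close> is \<open>F\<^sub>\<sigma>\<close>.
\<close>

lemma sets_fiber_card_ge:
  fixes \<pi> :: "'a::compact_metric_space \<Rightarrow> 'b::t2_space"
  assumes \<pi>: "continuous_on UNIV \<pi>"
  shows "{y. enat n \<le> fiber_card \<pi> y} \<in> sets borel"
proof -
  obtain \<B> :: "'a set set" where \<B>: "countable \<B>" "\<And>C. C \<in> \<B> \<Longrightarrow> closed C"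
    and sep: "\<And>F. finite F \<Longrightarrow>
      \<exists>c. \<forall>x\<in>F. c x \<in> \<B> \<and> x \<in> c x \<and> (\<forall>y\<in>F. y \<noteq> x \<longrightarrow> c x \<inter> c y = {})"
    using separating_closed_family[where 'a='a] by blast
  define \<D> where "\<D> = {D. finite D \<and> D \<subseteq> \<B> \<and> card D = n \<and> disjoint D}"
  have "{y. enat n \<le> fiber_card \<pi> y} = (\<Union>D\<in>\<D>. \<Inter>C\<in>D. \<pi> ` C)"
  proof (intro set_eqI iffI)
    fix y assume "y \<in> {y. enat n \<le> fiber_card \<pi> y}"
    then obtain F where F: "finite F" "card F = n" "F \<subseteq> \<pi> -` {y}"
      by (auto simp: enat_le_fiber_card_iff)
    from sep[OF F(1)] obtain c where c: "\<And>x. x \<in> F \<Longrightarrow> c x \<in> \<B>" "\<And>x. x \<in> F \<Longrightarrow> x \<in> c x"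
      "\<And>x y. x \<in> F \<Longrightarrow> y \<in> F \<Longrightarrow> y \<noteq> x \<Longrightarrow> c x \<inter> c y = {}"
      by blast
    \<comment> \<open>If two points shared a set, that set would be disjoint from itself although it
      contains a point.\<close>
    have "inj_on c F"
      by (rule inj_onI) (metis c(2,3) disjoint_iff)
    moreover have "disjoint (c ` F)"
      using c(3) by (auto intro!: pairwise_imageI simp: disjnt_def)
    ultimately have "c ` F \<in> \<D>"
      using F c(1) by (auto simp: \<D>_def card_image)
    moreover have "y \<in> (\<Inter>C\<in>c ` F. \<pi> ` C)"
      using F(3) c(2) by force
    ultimately show "y \<in> (\<Union>D\<in>\<D>. \<Inter>C\<in>D. \<pi> ` C)" by blast
  next
    fix y assume "y \<in> (\<Union>D\<in>\<D>. \<Inter>C\<in>D. \<pi> ` C)"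
    then obtain D where D: "finite D" "card D = n" "disjoint D" "\<forall>C\<in>D. \<exists>x\<in>C. \<pi> x = y"
      unfolding \<D>_def by (auto simp: image_iff) metis
    then obtain g where g: "\<And>C. C \<in> D \<Longrightarrow> g C \<in> C" "\<And>C. C \<in> D \<Longrightarrow> \<pi> (g C) = y"
      by metis
    have "inj_on g D"
      using D(3) g(1) by (intro inj_onI) (metis disjointD disjoint_iff)
    then show "y \<in> {y. enat n \<le> fiber_card \<pi> y}"
      using D g(2) by (auto simp: enat_le_fiber_card_iff card_image intro!: exI[of _ "g ` D"])
  qed
  also have "\<dots> \<in> sets borel"
  proof (rule sets.countable_UN'')
    have "\<D> \<subseteq> {D. finite D \<and> D \<subseteq> \<B>}" by (auto simp: \<D>_def)
    then show "countable \<D>"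
      by (rule countable_subset) (rule countable_Collect_finite_subset[OF \<B>(1)])
    \<comment> \<open>Compactness of the domain makes images of closed sets compact; images of
      arbitrary Borel sets would not be under such control.\<close>
    have "closed (\<pi> ` C)" if "C \<in> \<B>" for C
    proof -
      have "compact C"
        using \<B>(2)[OF that] compact_space compact_Int_closed[of UNIV C] by simp
      then show ?thesis
        using \<pi> by (intro compact_imp_closed compact_continuous_image)
          (auto intro: continuous_on_subset)
    qed
    then show "(\<Inter>C\<in>D. \<pi> ` C) \<in> sets borel" if "D \<in> \<D>" for D
      using that by (intro borel_closed closed_INT) (auto simp: \<D>_def)
  qed
  finally show ?thesis .
qed

text \<open>A finite value is cut out by two consecutive lower bounds, the value infinity by all
  lower bounds together.\<close>

lemma sets_fiber_card_eq:
  fixes \<pi> :: "'a::compact_metric_space \<Rightarrow> 'b::t2_space"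
  assumes "continuous_on UNIV \<pi>"
  shows "{y. fiber_card \<pi> y = c} \<in> sets borel"
proof (cases c)
  case (enat n)
  have "{y. fiber_card \<pi> y = c} = {y. enat n \<le> fiber_card \<pi> y} - {y. enat (Suc n) \<le> fiber_card \<pi> y}"
    by (auto simp: enat Suc_ile_eq)
  then show ?thesis
    using sets_fiber_card_ge[OF assms] by auto
next
  case infinity
  have "fiber_card \<pi> y = \<infinity> \<longleftrightarrow> (\<forall>n. enat n \<le> fiber_card \<pi> y)" for y
    by (cases "fiber_card \<pi> y") (auto intro: exI[of _ "Suc _"] simp: not_le)
  then have "{y. fiber_card \<pi> y = c} = (\<Inter>n. {y. enat n \<le> fiber_card \<pi> y})"
    by (auto simp: infinity)
  then show ?thesis
    using sets_fiber_card_ge[OF assms] by auto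
qed

text \<open>\<open>T\<close> maps the fiber over \<open>y\<close> bijectively onto the fiber over
  \<open>S y\<close>. For surjectivity, a point over \<open>S y\<close> has the form
  \<open>T z\<close>, and injectivity of \<open>S\<close> places \<open>z\<close> over
  \<open>y\<close>.\<close>

lemma fiber_card_equivariant:
  assumes "bij T" "inj S" "\<pi> \<circ> T = S \<circ> \<pi>"
  shows "fiber_card \<pi> (S y) = fiber_card \<pi> y"
proof -
  have comm: "\<pi> (T x) = S (\<pi> x)" for x
    using assms(3) by (metis comp_apply)
  have "\<pi> -` {S y} = T ` (\<pi> -` {y})"
  proof (intro set_eqI iffI)
    fix x assume "x \<in> \<pi> -` {S y}"
    moreover obtain z where "x = T z" using assms(1) by (metis bij_pointE)
    ultimately show "x \<in> T ` (\<pi> -` {y})"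
      using comm injD[OF assms(2)] by auto
  qed (auto simp: comm)
  moreover have "inj_on T (\<pi> -` {y})"
    using assms(1) by (auto simp: bij_def intro: inj_on_subset)
  ultimately show ?thesis
    by (simp add: fiber_card_def card_image finite_image_iff)
qed

text \<open>If no value had probability 1, each of the countably many values would be taken with
  probability 0, and so would their union, the whole space.\<close>

lemma AE_const_of_countable_range:
  fixes f :: "'a \<Rightarrow> 'c::countable"
  assumes "prob_space M"
    and meas: "\<And>c. {x \<in> space M. f x = c} \<in> sets M"
    and zero_one: "\<And>c. emeasure M {x \<in> space M. f x = c} = 0 \<or> emeasure M {x \<in> space M. f x = c} = 1"
  shows "\<exists>c. AE x in M. f x = c"
proof (rule ccontr)
  interpret prob_space M by fact
  assume no: "\<not> ?thesis"
  have "AE x in M. f x \<noteq> c" for c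
  proof (rule AE_I)
    show "emeasure M {x \<in> space M. f x = c} = 0"
      using zero_one[of c] no AE_I_eq_1[of "\<lambda>x. f x = c"] meas by blast
  qed (use meas in auto)
  then have "AE x in M. \<forall>c. f x \<noteq> c" by (intro AE_all_countable[THEN iffD2] allI)
  then have "AE x in M. False" by eventually_elim blast
  then show False by simp
qed

lemma top_dyn_system_bij: "top_dyn_system T \<Longrightarrow> bij T"
  unfolding top_dyn_system_def homeomorphism_def
  by (metis UNIV_I bijI' surj_def)

lemma top_dyn_system_measurable: "top_dyn_system T \<Longrightarrow> T \<in> borel_measurable borel"
  unfolding top_dyn_system_def homeomorphism_def
  by (auto intro: borel_measurable_continuous_onI)

text \<open>The level sets of the fiber cardinality are Borel and \<open>S\<close>-invariant, so
  ergodicity yields an almost sure value. It is unique because two almost sure values hold at a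
  common point; hence the description in \<open>factor_degree\<close> is proper.\<close>

lemma AE_fiber_card_eq_degree:
  assumes "factor_quadruple T S \<pi> \<nu>"
  shows "AE y in \<nu>. fiber_card \<pi> y = factor_degree \<pi> \<nu>"
proof -
  have fm: "factor_map T S \<pi>" and \<nu>: "\<nu> \<in> ergodic_measures borel S"
    using assms by (auto simp: factor_quadruple_def)
  note \<nu>' = invariant_measuresD[OF ergodic_measuresD(1)[OF \<nu>]]
  interpret prob_space \<nu> by fact
  have cont: "continuous_on UNIV \<pi>"
    using fm by (simp add: factor_map_def)
  have inv: "fiber_card \<pi> (S y) = fiber_card \<pi> y" for y
    using fm by (intro fiber_card_equivariant[of T])
      (auto simp: factor_map_def dest: top_dyn_system_bij intro: bij_is_inj)
  have "\<exists>c. AE y in \<nu>. fiber_card \<pi> y = c"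
  proof (rule AE_const_of_countable_range)
    show "prob_space \<nu>" by fact
    show "{y \<in> space \<nu>. fiber_card \<pi> y = c} \<in> sets \<nu>" for c
      using sets_fiber_card_eq[OF cont] \<nu>' by simp
    show "emeasure \<nu> {y \<in> space \<nu>. fiber_card \<pi> y = c} = 0 \<or>
        emeasure \<nu> {y \<in> space \<nu>. fiber_card \<pi> y = c} = 1" for c
      using ergodic_measuresD(2)[OF \<nu> sets_fiber_card_eq[OF cont, of c]] \<nu>' by (simp add: inv)
  qed
  moreover have "c = c'" if "AE y in \<nu>. fiber_card \<pi> y = c" "AE y in \<nu>. fiber_card \<pi> y = c'" for c c'
  proof -
    have "AE y in \<nu>. c = c'" using that by eventually_elim simp
    then show ?thesis by simp
  qed
  ultimately have "\<exists>!c. AE y in \<nu>. fiber_card \<pi> y = c"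
    by (rule ex_ex1I)
  then show ?thesis
    unfolding factor_degree_def by (rule theI')
qed

section \<open>Marginals of a degree joining\<close>

lemma measurable_power_space_component:
  "i \<in> {1..n} \<Longrightarrow> (\<lambda>x. x i) \<in> measurable (power_space n) borel"
  unfolding power_space_def by (rule measurable_component_singleton)

lemma measurable_power_map:
  assumes "T \<in> borel_measurable borel"
  shows "power_map n T \<in> measurable (power_space n) (power_space n)"
proof -
  have "(\<lambda>x. T (x i)) \<in> measurable (power_space n) borel" if "i \<in> {1..n}" for i
    using measurable_compose[OF measurable_power_space_component[OF that] assms] .
  then show ?thesis
    unfolding power_map_def power_space_def by (intro measurable_restrict) auto
qed

lemma relative_joining_AE_fiber:
  assumes "relative_joining n T \<pi> J"
  shows "AE x in J. \<forall>i\<in>{1..n}. \<forall>j\<in>{1..n}. \<pi> (x i) = \<pi> (x j)"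
proof -
  have "emeasure J (fiber_product n \<pi>) = 1" "prob_space J"
    using assms by (auto simp: relative_joining_def dest: invariant_measuresD)
  \<comment> \<open>Measurability of the fiber product comes for free: \<open>emeasure\<close> is 0
    on sets outside \<open>sets J\<close>, so the value 1 rules that out.\<close>
  then have "AE x in J. x \<in> fiber_product n \<pi>"
    using emeasure_notin_sets[of "fiber_product n \<pi>" J] prob_space.AE_in_set_eq_1[of J "fiber_product n \<pi>"]
    by (auto simp: measure_def)
  then show ?thesis
    by eventually_elim (unfold fiber_product_def mem_Collect_eq, rule conjunct2)
qed

text \<open>Almost surely no coordinate lies in \<open>A\<close>, and the coordinates fill the
  fiber, so the whole fiber misses \<open>A\<close>. As the image of \<open>A\<close> under
  \<open>\<pi>\<close> need not be Borel, the transfer to \<open>\<nu>\<close> and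
  \<open>\<mu>\<close> is made for compact subsets of \<open>A\<close>, whose images are
  closed.\<close>

lemma emeasure_eq_0_of_null_marginals:
  fixes \<pi> :: "'a::compact_metric_space \<Rightarrow> 'b::t2_space"
  assumes \<pi>: "continuous_on UNIV \<pi>"
    and sets_J: "sets J = sets (power_space d)"
    and i: "i \<in> {1..d}" and \<nu>: "distr (distr J borel (\<lambda>x. x i)) borel \<pi> = \<nu>"
    and fib: "AE x in J. \<pi> -` {\<pi> (x i)} = x ` {1..d}"
    and \<mu>: "finite_measure \<mu>" "sets \<mu> = sets borel" "distr \<mu> borel \<pi> = \<nu>"
    and A: "A \<in> sets borel" "\<And>j. j \<in> {1..d} \<Longrightarrow> emeasure (distr J borel (\<lambda>x. x j)) A = 0"
  shows "emeasure \<mu> A = 0"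
proof -
  have \<pi>m: "\<pi> \<in> borel_measurable borel"
    using \<pi> by (rule borel_measurable_continuous_onI)
  have comp: "(\<lambda>x. x j) \<in> measurable J borel" if "j \<in> {1..d}" for j
    using measurable_power_space_component[OF that] sets_J by (auto cong: measurable_cong_sets)
  have "AE x in J. \<forall>j\<in>{1..d}. x j \<notin> A"
  proof (rule AE_finite_allI)
    fix j assume j: "j \<in> {1..d}"
    have "AE z in distr J borel (\<lambda>x. x j). z \<notin> A"
      using A j by (intro AE_not_in) auto
    then show "AE x in J. x j \<notin> A"
      using comp[OF j] by (rule AE_distrD[rotated])
  qed simp
  then have avoid: "AE x in J. \<pi> (x i) \<notin> \<pi> ` A"
    using fib
  proof eventually_elim
    case (elim x)
    have "z \<notin> A" if "\<pi> z = \<pi> (x i)" for z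
    proof -
      have "z \<in> x ` {1..d}" using elim(2) that by blast
      then show ?thesis using elim(1) by blast
    qed
    then show ?case by force
  qed
  have "emeasure \<mu> K = 0" if K: "K \<subseteq> A" "compact K" for K
  proof -
    have cl: "closed (\<pi> ` K)"
      using K(2) \<pi> by (intro compact_imp_closed compact_continuous_image)
        (auto intro: continuous_on_subset)
    have off: "AE x in J. \<pi> (x i) \<notin> \<pi> ` K"
      using avoid by eventually_elim (use K(1) in auto)
    \<comment> \<open>Written as the law of \<open>\<pi> (x i)\<close>, \<open>\<nu>\<close>
      inherits the almost sure statement about \<open>J\<close>. It then lifts to
      \<open>\<mu>\<close>, because \<open>K\<close> lies in the preimage of its own image.\<close>
    have eq: "\<nu> = distr J borel (\<lambda>x. \<pi> (x i))"
      using distr_distr[OF \<pi>m comp[OF i]] \<nu> by (simp add: comp_def)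
    have "{y \<in> space borel. y \<notin> \<pi> ` K} \<in> sets borel"
      using borel_comp[OF borel_closed[OF cl]] by (simp add: Compl_eq)
    then have "AE y in \<nu>. y \<notin> \<pi> ` K"
      unfolding eq using off
      by (rule AE_distr_iff[OF measurable_compose[OF comp[OF i] \<pi>m], THEN iffD2])
    then have "AE x in \<mu>. \<pi> x \<notin> \<pi> ` K"
      unfolding \<mu>(3)[symmetric]
      by (rule AE_distrD[rotated]) (use \<pi>m \<mu>(2) in \<open>auto cong: measurable_cong_sets\<close>)
    then have "AE x in \<mu>. x \<notin> K"
      by eventually_elim auto
    then show ?thesis
      using K(2) \<mu>(2) sets_eq_imp_space_eq[OF \<mu>(2)]
      by (subst (asm) AE_iff_measurable[of K]) (auto intro: compact_imp_closed borel_closed)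
  qed
  \<comment> \<open>Inner regularity applies because a compact metric space is Polish and
    \<open>\<mu>\<close> is finite.\<close>
  moreover have "emeasure \<mu> A = (SUP K \<in> {K. K \<subseteq> A \<and> compact K}. emeasure \<mu> K)"
    using \<mu> A(1) by (intro inner_regular) (auto simp: finite_measure.emeasure_finite)
  ultimately show ?thesis by (auto intro!: antisym SUP_least)
qed

theorem theorem5p1:
  fixes T :: "'a::compact_metric_space \<Rightarrow> 'a"
    and S :: "'b::compact_metric_space \<Rightarrow> 'b"
    and \<pi> :: "'a \<Rightarrow> 'b"
    and \<nu> :: "'b measure"
    and J :: "(nat \<Rightarrow> 'a) measure"
    and d :: nat
  assumes "factor_quadruple T S \<pi> \<nu>"
    and "factor_degree \<pi> \<nu> = enat d"
    and "degree_joining T \<pi> \<nu> J"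
  shows "{distr J borel (\<lambda>x. x i) | i. i \<in> {1..d}} =
         {\<mu> \<in> ergodic_measures borel T. distr \<mu> borel \<pi> = \<nu>}"
proof -
  let ?p = "\<lambda>i. distr J borel (\<lambda>x. x i)"
  have rel: "relative_joining d T \<pi> J" and "joining_over d \<pi> \<nu> J" and inj: "AE x in J. inj_on x {1..d}"
    and erg: "J \<in> ergodic_measures (power_space d) (power_map d T)"
    using assms(2,3) by (auto simp: degree_joining_def separating_def)
  then obtain i where i: "i \<in> {1..d}" "distr (?p i) borel \<pi> = \<nu>"
    by (auto simp: joining_over_def)
  have \<pi>: "continuous_on UNIV \<pi>" and T: "T \<in> borel_measurable borel"
    using assms(1) by (auto simp: factor_quadruple_def factor_map_def top_dyn_system_measurable)
  have \<pi>m: "\<pi> \<in> borel_measurable borel"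
    using \<pi> by (rule borel_measurable_continuous_onI)
  note J = invariant_measuresD[OF ergodic_measuresD(1)[OF erg]]
  have comp: "(\<lambda>x. x j) \<in> measurable J borel" if "j \<in> {1..d}" for j
    using measurable_power_space_component[OF that] J(2) by (auto cong: measurable_cong_sets)
  have same: "AE x in J. \<forall>j\<in>{1..d}. \<forall>k\<in>{1..d}. \<pi> (x j) = \<pi> (x k)"
    using rel by (rule relative_joining_AE_fiber)
  \<comment> \<open>\<open>joining_over\<close> provides a single index \<open>i\<close>; the others
    follow since all coordinates have almost surely the same image under
    \<open>\<pi>\<close>.\<close>
  have over: "distr (?p j) borel \<pi> = \<nu>" if j: "j \<in> {1..d}" for j
  proof -
    have "distr (?p j) borel \<pi> = distr J borel (\<lambda>x. \<pi> (x j))"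
      using distr_distr[OF \<pi>m comp[OF j]] by (simp add: comp_def)
    also have "\<dots> = distr J borel (\<lambda>x. \<pi> (x i))"
    proof (rule distr_cong_AE)
      show "AE x in J. \<pi> (x j) = \<pi> (x i)"
        using same by eventually_elim (use i(1) j in blast)
    qed (use comp[OF j] comp[OF i(1)] \<pi>m in \<open>auto intro: measurable_compose\<close>)
    also have "\<dots> = \<nu>"
      using distr_distr[OF \<pi>m comp[OF i(1)]] i(2) by (simp add: comp_def)
    finally show ?thesis .
  qed
  have p_erg: "?p j \<in> ergodic_measures borel T" if "j \<in> {1..d}" for j
    using erg measurable_power_map[OF T] T measurable_power_space_component[OF that]
    by (rule ergodic_measures_distr) (use that in \<open>simp add: power_map_def\<close>)
  have "AE x in J. fiber_card \<pi> (\<pi> (x i)) = enat d"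
  proof -
    have "AE y in distr (?p i) borel \<pi>. fiber_card \<pi> y = enat d"
      using AE_fiber_card_eq_degree[OF assms(1)] unfolding assms(2) i(2) .
    then have "AE z in ?p i. fiber_card \<pi> (\<pi> z) = enat d"
      by (rule AE_distrD[rotated]) (simp add: \<pi>m)
    then show ?thesis
      by (rule AE_distrD[OF comp[OF i(1)]])
  qed
  \<comment> \<open>Separation gives \<open>d\<close> distinct points inside a fiber with exactly
    \<open>d\<close> elements, so they exhaust it.\<close>
  then have fib: "AE x in J. \<pi> -` {\<pi> (x i)} = x ` {1..d}"
    using same inj
  proof eventually_elim
    case (elim x)
    have "finite (\<pi> -` {\<pi> (x i)})" "card (\<pi> -` {\<pi> (x i)}) = d"
      using elim(1) by (auto simp: fiber_card_def split: if_splits)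
    moreover have "x ` {1..d} \<subseteq> \<pi> -` {\<pi> (x i)}"
      using elim(2) i(1) by blast
    ultimately show ?case
      using card_image[OF elim(3)] by (intro card_subset_eq[symmetric]) auto
  qed
  have "\<exists>j\<in>{1..d}. \<mu> = ?p j" if \<mu>: "\<mu> \<in> ergodic_measures borel T" "distr \<mu> borel \<pi> = \<nu>" for \<mu>
  proof (rule ccontr)
    note \<mu>' = invariant_measuresD[OF ergodic_measuresD(1)[OF \<mu>(1)]]
    interpret \<mu>: prob_space \<mu> by fact
    assume no: "\<not> ?thesis"
    have "\<exists>A. A \<in> sets borel \<and> emeasure \<mu> A = 1 \<and> emeasure (?p j) A = 0" if "j \<in> {1..d}" for j
      using ergodic_measures_singular[OF T \<mu>(1) p_erg[OF that]] no that by blast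
    then obtain A where A: "\<And>j. j \<in> {1..d} \<Longrightarrow> A j \<in> sets borel"
      "\<And>j. j \<in> {1..d} \<Longrightarrow> emeasure \<mu> (A j) = 1" "\<And>j. j \<in> {1..d} \<Longrightarrow> emeasure (?p j) (A j) = 0"
      by metis
    \<comment> \<open>The sets \<open>A j\<close> have full \<open>\<mu>\<close>-measure, each being
      null for its own marginal. Their finite intersection keeps full \<open>\<mu>\<close>-measure
      and is null for all marginals at once; \<open>i\<close> shows that the index set is
      nonempty.\<close>
    define B where "B = (\<Inter>j\<in>{1..d}. A j)"
    have B: "B \<in> sets borel"
      unfolding B_def using A(1) i(1) by (intro sets.finite_INT) auto
    have "emeasure (?p j) B = 0" if j: "j \<in> {1..d}" for j
    proof -
      have "emeasure (?p j) B \<le> emeasure (?p j) (A j)"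
        using A(1)[OF j] j by (intro emeasure_mono) (auto simp: B_def)
      then show ?thesis using A(3)[OF j] by simp
    qed
    \<comment> \<open>Being null for every marginal forces \<open>B\<close> to be null for any
      measure over \<open>\<nu>\<close>, against its full \<open>\<mu>\<close>-measure.\<close>
    then have "emeasure \<mu> B = 0"
      using emeasure_eq_0_of_null_marginals[OF \<pi> J(2) i fib _ \<mu>'(2) \<mu>(2) B] \<mu>.finite_measure_axioms
      by blast
    moreover have "AE x in \<mu>. x \<in> B"
    proof -
      have "AE x in \<mu>. \<forall>j\<in>{1..d}. x \<in> A j"
      proof (rule AE_finite_allI)
        fix j assume j: "j \<in> {1..d}"
        show "AE x in \<mu>. x \<in> A j"
          using A(1,2)[OF j] \<mu>'(2) \<mu>.AE_in_set_eq_1[of "A j"] by (simp add: measure_def)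
      qed simp
      then show ?thesis by (simp add: B_def)
    qed
    ultimately show False
      using B \<mu>'(2) \<mu>.AE_in_set_eq_1[of B] by (simp add: measure_def)
  qed
  then show ?thesis
    using over p_erg by blast
qed

end
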